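(* Let $d\ge2$ be an integer, let $1^*=\frac{d}{d-1}$, let $1\le q\le r<\infty$ and $\alpha,\beta\in\mathbb{R}$, and let $\theta\in(0,1]$ be the solution of $$\frac1r=\frac{\theta}{q}+\frac{1-\theta}{r+1^*}.$$ There is a constant $C$ depending only on $d,q,r,\alpha,\beta$ such that for every $\tau>0$ and every smooth compactly supported function $u$ on $\Sigma_\tau\cong\mathbb{R}^d$, $$\left(\tau^{1/d}\right)^{\frac{r-q}{r}}\|u\|_{\mathcal{L}^r_{1+\theta\beta r+\alpha r}}\le C\left(\|u\|_{\mathcal{L}^q_{1+\beta q+\alpha q}}\right)^{q/r}\left(\|u\|_{\mathcal{W}^{1,d}_{(1-d)(1+\beta\theta r)+\alpha d}}\right)^{(r-q)/r}.$$
   Context: For $\tau>0$ let $\Sigma_\tau=\{(t,x)\in\mathbb{R}^{1+d}: t^2-|x|^2=\tau^2,\ t>0\}$, parametrized by $x\in\mathbb{R}^d$ via $x\mapsto(\sqrt{\tau^2+|x|^2},x)$, and let $w_\tau(x)=\sqrt{\tau^2+|x|^2}$. The induced volume form is $\mathrm{dvol}=\frac{\tau}{w_\tau}\,dx^1\cdots dx^d$. The Lorentz boosts $L^i=x^i\partial_t+t\partial_{x^i}$ are tangent to $\Sigma_\tau$ and act there as $L^i=w_\tau\partial_{x^i}$. For $p\in[1,\infty)$, $\alpha\in\mathbb{R}$, $k\in\mathbb{N}$: $\|u\|_{\mathcal{L}^p_\alpha}=\left(\int_{\Sigma_\tau} w_\tau^\alpha|u|^p\,\mathrm{dvol}\right)^{1/p}$,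 $\|u\|_{\mathring{\mathcal{W}}^{k,p}_\alpha}=\sum_{i_1,\dots,i_k=1}^d\|L^{i_1}\cdots L^{i_k}u\|_{\mathcal{L}^p_\alpha}$ (with $\mathring{\mathcal W}^{0,p}_\alpha=\mathcal{L}^p_\alpha$), and $\|u\|_{\mathcal{W}^{k,p}_\alpha}=\sum_{j=0}^k\|u\|_{\mathring{\mathcal{W}}^{j,p}_\alpha}$. *)

theory Defs
  imports "HOL-Analysis.Analysis"
begin

text \<open>
  Points of \<open>\<real>\<^bsup>1+d\<^esup>\<close> are pairs \<open>(t, x)\<close> with \<open>x :: real ^ 'd\<close>, and \<open>d\<close> is \<open>CARD('d)\<close>.
  A function on \<open>hyperboloid \<tau>\<close> is represented by a total function on \<open>\<real>\<^bsup>1+d\<^esup>\<close>; everything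
  below depends only on its values on the hyperboloid.
\<close>

definition hyperboloid :: "real \<Rightarrow> (real \<times> (real ^ 'd)) set" where
  "hyperboloid \<tau> = {(t, x). t\<^sup>2 - (norm x)\<^sup>2 = \<tau>\<^sup>2 \<and> t > 0}"

definition hyp_weight :: "real \<Rightarrow> real ^ 'd \<Rightarrow> real" where
  "hyp_weight \<tau> x = sqrt (\<tau>\<^sup>2 + (norm x)\<^sup>2)"

definition hyp_param :: "real \<Rightarrow> real ^ 'd \<Rightarrow> real \<times> (real ^ 'd)" where
  "hyp_param \<tau> x = (hyp_weight \<tau> x, x)"

primrec k_times_cont_diff :: "nat \<Rightarrow> ('a::real_normed_vector \<Rightarrow> 'b::real_normed_vector) \<Rightarrow> bool" where
  "k_times_cont_diff 0 f \<longleftrightarrow> continuous_on UNIV f"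
| "k_times_cont_diff (Suc k) f \<longleftrightarrow>
     (\<forall>x. f differentiable (at x)) \<and>
     (\<forall>v. k_times_cont_diff k (\<lambda>x. frechet_derivative f (at x) v))"

definition smooth_fun :: "('a::real_normed_vector \<Rightarrow> 'b::real_normed_vector) \<Rightarrow> bool" where
  "smooth_fun f \<longleftrightarrow> (\<forall>k. k_times_cont_diff k f)"

definition smooth_compact_support :: "real \<Rightarrow> (real \<times> (real ^ 'd) \<Rightarrow> 'b::real_normed_vector) \<Rightarrow> bool" where
  "smooth_compact_support \<tau> u \<longleftrightarrow>
     smooth_fun (u \<circ> hyp_param \<tau>) \<and>
     (\<exists>K. compact K \<and> K \<subseteq> hyperboloid \<tau> \<and> (\<forall>p \<in> hyperboloid \<tau> - K. u p = 0))"

text \<open>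
  The boost \<open>x\<^sup>i \<partial>\<^sub>t + t \<partial>\<^sub>i\<close>, acting on functions on the hyperboloid through the chart as
  \<open>w\<^sub>\<tau> \<partial>\<^sub>i\<close>. Lemma \<open>boost_ambient\<close> below checks that this is the restriction of the ambient
  vector field.
\<close>

definition boost :: "real \<Rightarrow> 'd \<Rightarrow> (real \<times> (real ^ 'd) \<Rightarrow> 'b) \<Rightarrow>
    (real \<times> (real ^ 'd) \<Rightarrow> 'b::real_normed_vector)" where
  "boost \<tau> i u = (\<lambda>(t, x). hyp_weight \<tau> x *\<^sub>R
     frechet_derivative (u \<circ> hyp_param \<tau>) (at x) (axis i 1))"

text \<open>The factor \<open>\<tau> / w\<^sub>\<tau>\<close> is the density of the induced volume form in the chart.\<close>

definition L_norm :: "real \<Rightarrow> real \<Rightarrow> real \<Rightarrow> (real \<times> (real ^ 'd) \<Rightarrow> 'b::real_normed_vector) \<Rightarrow> real" where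
  "L_norm \<tau> p \<alpha> u =
     (\<integral>x. hyp_weight \<tau> x powr \<alpha> * norm (u (hyp_param \<tau> x)) powr p * (\<tau> / hyp_weight \<tau> x) \<partial>lborel)
       powr (1 / p)"

text \<open>\<open>foldr (boost \<tau>) [i\<^sub>1, \<dots>, i\<^sub>k] u\<close> is \<open>L\<^bsup>i\<^sub>1\<^esup> \<dots> L\<^bsup>i\<^sub>k\<^esup> u\<close>.\<close>

definition W_hom_norm :: "real \<Rightarrow> nat \<Rightarrow> real \<Rightarrow> real \<Rightarrow>
    (real \<times> (real ^ 'd) \<Rightarrow> 'b::real_normed_vector) \<Rightarrow> real" where
  "W_hom_norm \<tau> k p \<alpha> u = (\<Sum>is | length is = k. L_norm \<tau> p \<alpha> (foldr (boost \<tau>) is u))"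

definition W_norm :: "real \<Rightarrow> nat \<Rightarrow> real \<Rightarrow> real \<Rightarrow>
    (real \<times> (real ^ 'd) \<Rightarrow> 'b::real_normed_vector) \<Rightarrow> real" where
  "W_norm \<tau> k p \<alpha> u = (\<Sum>j\<le>k. W_hom_norm \<tau> j p \<alpha> u)"

lemma hyperboloid_eq_range:
  assumes "\<tau> > 0"
  shows "hyperboloid \<tau> = range (hyp_param \<tau> :: real ^ 'd \<Rightarrow> _)"
proof -
  have "t = sqrt (\<tau>\<^sup>2 + (norm x)\<^sup>2)" if "t\<^sup>2 - (norm x)\<^sup>2 = \<tau>\<^sup>2" "t > 0" for t and x :: "real ^ 'd"
    using that by (smt (verit) real_sqrt_unique)
  moreover have "sqrt (\<tau>\<^sup>2 + (norm x)\<^sup>2) > 0" for x :: "real ^ 'd"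
    using assms by (simp add: add_pos_nonneg)
  ultimately show ?thesis
    by (fastforce simp: hyperboloid_def hyp_param_def hyp_weight_def image_iff)
qed

lemma boost_ambient:
  fixes F :: "real \<times> (real ^ 'd) \<Rightarrow> 'b::real_normed_vector"
  assumes "\<tau> > 0" and F: "(F has_derivative F') (at (hyp_param \<tau> x))"
  shows "boost \<tau> i F (hyp_param \<tau> x) = x $ i *\<^sub>R F' (1, 0) + hyp_weight \<tau> x *\<^sub>R F' (0, axis i 1)"
proof -
  have pos: "\<tau>\<^sup>2 + x \<bullet> x > 0" by (rule add_pos_nonneg) (use assms(1) in auto)
  define w where "w = hyp_weight \<tau> x"
  have w: "w = sqrt (\<tau>\<^sup>2 + x \<bullet> x)" "w > 0"
    using pos by (simp_all add: w_def hyp_weight_def power2_norm_eq_inner)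
  have q: "((\<lambda>y. \<tau>\<^sup>2 + y \<bullet> y) has_derivative (\<lambda>v. 0 + (x \<bullet> v + v \<bullet> x))) (at x)"
    by (intro has_derivative_add has_derivative_const has_derivative_inner has_derivative_ident)
  have "((\<lambda>y. sqrt (\<tau>\<^sup>2 + y \<bullet> y)) has_derivative
      (\<lambda>v. (0 + (x \<bullet> v + v \<bullet> x)) * (inverse (sqrt (\<tau>\<^sup>2 + x \<bullet> x)) / 2))) (at x)"
    by (rule has_derivative_real_sqrt[where g = "\<lambda>y. \<tau>\<^sup>2 + y \<bullet> y", OF pos q])
  moreover have "(0 + (x \<bullet> v + v \<bullet> x)) * (inverse (sqrt (\<tau>\<^sup>2 + x \<bullet> x)) / 2) = (x \<bullet> v) / w" for v
  proof -
    have e: "v \<bullet> x = x \<bullet> v" by (rule inner_commute)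
    have "(0 + (a + a)) * (inverse c / 2) = a / c" for a c :: real
      unfolding divide_inverse by algebra
    then show ?thesis unfolding e w(1) .
  qed
  ultimately have P: "(hyp_param \<tau> has_derivative (\<lambda>v. ((x \<bullet> v) / w, v))) (at x)"
    unfolding hyp_param_def hyp_weight_def power2_norm_eq_inner
    by (intro has_derivative_Pair has_derivative_ident) (simp only:)
  interpret F': bounded_linear F' using F by (rule has_derivative_bounded_linear)
  have "((F \<circ> hyp_param \<tau>) has_derivative (F' \<circ> (\<lambda>v. ((x \<bullet> v) / w, v)))) (at x)"
    by (rule diff_chain_at[OF P F])
  then have D: "frechet_derivative (F \<circ> hyp_param \<tau>) (at x) = F' \<circ> (\<lambda>v. ((x \<bullet> v) / w, v))"
    by (rule frechet_derivative_at[symmetric])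
  have "boost \<tau> i F (hyp_param \<tau> x) = w *\<^sub>R F' (x $ i / w, axis i 1)"
    by (simp only: boost_def hyp_param_def[of \<tau> x] split_conv D comp_apply inner_axis w_def inner_real_def mult_1_right)
  also have "\<dots> = F' (w *\<^sub>R (x $ i / w, axis i 1))"
    by (rule F'.scaleR[symmetric])
  also have "w *\<^sub>R (x $ i / w, axis i 1) = (x $ i) *\<^sub>R (1, 0) + w *\<^sub>R (0, axis i 1)"
    using w(2) by simp
  also have "F' \<dots> = x $ i *\<^sub>R F' (1, 0) + w *\<^sub>R F' (0, axis i 1)"
    by (subst F'.add, subst (1 2) F'.scaleR, rule refl)
  finally show ?thesis by (simp only: w_def)
qed

end

theory Submission
  imports Defs
begin

text \<open>
  In the chart \<open>x \<mapsto> (w x, x)\<close>, with \<open>w = hyp_weight \<tau>\<close>, every norm is an integral over \<open>\<real>\<^sup>d\<close> of a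
  power of \<open>w\<close> times a power of \<open>|v|\<close> or of \<open>|w \<partial>\<^sub>i v|\<close>, multiplied by \<open>\<tau>\<close>. Both sides of the claim
  carry the same total power of \<open>\<tau>\<close>, so it reads \<open>A \<le> K' Q W\<^bsup>r-q\<^esup>\<close>, where \<open>A\<close> and \<open>Q\<close> are the integrals
  of \<open>|v|\<^sup>r\<close> and \<open>|v|\<^sup>q\<close> against powers of \<open>w\<close>, and \<open>W\<close> is the first-order weighted norm of \<open>v\<close> in
  \<open>L\<^sup>d\<close>. With \<open>m = 1*\<close> and the auxiliary integral \<open>S\<close> of \<open>(w\<^sup>\<alpha> |v|)\<^bsup>r+m\<^esup>\<close>, this follows from two bounds.

  \<^item> Sobolev: \<open>S \<le> K A W\<^sup>m\<close>. The \<open>L\<^sup>1\<close> Sobolev inequality is applied to \<open>(w\<^sup>\<alpha> |v|)\<^sup>p\<close> with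
    \<open>p = 1 + r/m > 1\<close>, whose \<open>m\<close>-th power is the integrand of \<open>S\<close>. Since \<open>|\<nabla>w| \<le> 1\<close>, its gradient is
    at most a constant times \<open>w\<^bsup>\<alpha>p-1\<^esup> |v|\<^bsup>p-1\<^esup> (|v| + \<Sum>\<^sub>i |w \<partial>\<^sub>i v|)\<close>: the derivatives of \<open>v\<close> enter
    only as boosts, and a derivative falling on the weight costs \<open>1/w\<close> (\<open>weighted_Sobolev\<close>). The
    Hoelder inequality with exponents \<open>m\<close> and \<open>d\<close> then splits off \<open>A\<close> and \<open>W\<close>.
  \<^item> Interpolation: \<open>A \<le> Q\<^sup>l S\<^bsup>1-l\<^esup>\<close> with \<open>l = \<theta> r / q\<close>, which is the Hoelder inequality once more
    (\<open>weighted_power_integral_Holder\<close>); the relation that defines \<open>\<theta>\<close> says that the exponents match.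

  Substituting the first bound into the second leaves \<open>A\<^bsup>1-l\<^esup>\<close> on the right, which is absorbed on the
  left (\<open>absorption\<close>). The only quantitative property of \<open>w\<close> that enters is \<open>|\<nabla>w| \<le> 1\<close>, so the
  constant does not depend on \<open>\<tau>\<close>.

  The \<open>L\<^sup>1\<close> Sobolev inequality (\<open>Gagliardo_Nirenberg_Sobolev\<close>) is Gagliardo's argument: \<open>|f x|\<close> is at
  most the integral of \<open>|\<partial>\<^sub>i f|\<close> along the \<open>i\<close>-th coordinate line through \<open>x\<close>, for each \<open>i\<close>, so
  \<open>|f|\<^bsup>d/(d-1)\<^esup>\<close> is at most the product of the \<open>d\<close> line integrals to the power \<open>1/(d-1)\<close>. The integral
  of such a product is controlled by \<open>grid_inequality\<close>, by induction on the number of coordinates.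
\<close>

section \<open>The Hoelder inequality for finitely many functions\<close>

text \<open>This is the convexity of \<open>exp\<close>, once the degenerate case of a zero factor is set aside.\<close>

lemma weighted_arith_geom_mean:
  fixes a p :: "'k \<Rightarrow> real"
  assumes "finite K" and p: "\<And>k. k \<in> K \<Longrightarrow> 0 \<le> p k" "(\<Sum>k\<in>K. p k) = 1"
    and a: "\<And>k. k \<in> K \<Longrightarrow> 0 \<le> a k"
  shows "(\<Prod>k\<in>K. a k powr p k) \<le> (\<Sum>k\<in>K. p k * a k)"
proof (cases "\<exists>k\<in>K. a k = 0")
  case True
  then have "(\<Prod>k\<in>K. a k powr p k) = 0"
    using \<open>finite K\<close> by (auto intro!: prod_zero)
  then show ?thesis
    using p a by (simp add: sum_nonneg)
next
  case False
  then have pos: "a k > 0" if "k \<in> K" for k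
    using a[OF that] that by force
  have "K \<noteq> {}" using p(2) by auto
  have "(\<Prod>k\<in>K. a k powr p k) = exp (\<Sum>k\<in>K. p k *\<^sub>R ln (a k))"
    using pos by (auto simp: powr_def exp_sum[OF \<open>finite K\<close>] less_imp_neq[symmetric] intro!: prod.cong)
  also have "\<dots> \<le> (\<Sum>k\<in>K. p k * exp (ln (a k)))"
    by (rule convex_on_sum[OF \<open>finite K\<close> \<open>K \<noteq> {}\<close> exp_convex p(2)]) (use p in auto)
  also have "\<dots> = (\<Sum>k\<in>K. p k * a k)"
    using pos by simp
  finally show ?thesis .
qed

text \<open>
  After normalizing each \<open>g k\<close> to have integral 1, the weighted arithmetic-geometric mean inequality
  holds pointwise and only has to be integrated. Zero exponents are harmless: \<open>0 powr 0 = 0\<close> makes the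
  product on the left vanish wherever some \<open>g k\<close> does.
\<close>

lemma Holder_integral_prod:
  fixes g :: "'k \<Rightarrow> 'a \<Rightarrow> real" and p :: "'k \<Rightarrow> real"
  assumes K: "finite K" and p: "\<And>k. k \<in> K \<Longrightarrow> 0 \<le> p k" "(\<Sum>k\<in>K. p k) = 1"
    and g: "\<And>k. k \<in> K \<Longrightarrow> integrable M (g k)" "\<And>k x. k \<in> K \<Longrightarrow> 0 \<le> g k x"
  shows "(\<integral>x. (\<Prod>k\<in>K. g k x powr p k) \<partial>M) \<le> (\<Prod>k\<in>K. (\<integral>x. g k x \<partial>M) powr p k)"
proof (cases "\<exists>k\<in>K. (\<integral>x. g k x \<partial>M) = 0")
  case True
  then obtain k where k: "k \<in> K" "(\<integral>x. g k x \<partial>M) = 0" by auto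
  then have "AE x in M. g k x = 0"
    using integral_nonneg_eq_0_iff_AE[OF g(1)[OF k(1)]] g(2) by auto
  then have "AE x in M. (\<Prod>k\<in>K. g k x powr p k) = 0"
    by eventually_elim (use k(1) K in \<open>auto intro!: prod_zero\<close>)
  then have "(\<integral>x. (\<Prod>k\<in>K. g k x powr p k) \<partial>M) = 0"
    by (rule integral_eq_zero_AE)
  then show ?thesis by (simp add: prod_nonneg)
next
  case False
  define G where "G k = (\<integral>x. g k x \<partial>M)" for k
  have G: "G k > 0" if "k \<in> K" for k
    using False that g(2)[OF that] unfolding G_def
    by (metis less_eq_real_def integral_nonneg_AE AE_I2)
  have "(\<integral>x. (\<Prod>k\<in>K. g k x powr p k) \<partial>M) \<le>
    (\<integral>x. (\<Prod>k\<in>K. G k powr p k) * (\<Sum>k\<in>K. p k * (g k x / G k)) \<partial>M)"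
  proof (rule integral_mono')
    show "integrable M (\<lambda>x. (\<Prod>k\<in>K. G k powr p k) * (\<Sum>k\<in>K. p k * (g k x / G k)))"
      by (intro integrable_mult_right integrable_sum integrable_divide) (use g in auto)
  next
    fix x
    have "(\<Prod>k\<in>K. g k x powr p k) = (\<Prod>k\<in>K. G k powr p k * (g k x / G k) powr p k)"
      using G g(2) by (intro prod.cong) (simp_all add: powr_mult[symmetric] less_imp_le less_imp_neq[symmetric])
    also have "\<dots> = (\<Prod>k\<in>K. G k powr p k) * (\<Prod>k\<in>K. (g k x / G k) powr p k)"
      by (rule prod.distrib)
    also have "\<dots> \<le> (\<Prod>k\<in>K. G k powr p k) * (\<Sum>k\<in>K. p k * (g k x / G k))"
      using G g(2) K p by (intro mult_left_mono weighted_arith_geom_mean prod_nonneg) (auto simp: less_imp_le)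
    finally show "(\<Prod>k\<in>K. g k x powr p k) \<le> \<dots>" .
    show "0 \<le> (\<Prod>k\<in>K. G k powr p k) * (\<Sum>k\<in>K. p k * (g k x / G k))"
      using G g(2) p by (intro mult_nonneg_nonneg prod_nonneg sum_nonneg) (auto simp: less_imp_le)
  qed
  also have "\<dots> = (\<Prod>k\<in>K. G k powr p k) * (\<Sum>k\<in>K. p k * (G k / G k))"
  proof -
    have "(\<integral>x. (\<Sum>k\<in>K. p k * (g k x / G k)) \<partial>M) = (\<Sum>k\<in>K. p k * (G k / G k))"
      unfolding G_def using g(1)
      by (subst Bochner_Integration.integral_sum) (auto simp only: integrable_mult_right
        integrable_divide integral_mult_right_zero integral_divide_zero)
    then show ?thesis by simp
  qed
  also have "(\<Sum>k\<in>K. p k * (G k / G k)) = (\<Sum>k\<in>K. p k)"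
    using G by (intro sum.cong) (auto simp: less_imp_neq[symmetric])
  finally show ?thesis
    by (simp add: p(2) G_def)
qed

lemma Holder_integral_mult:
  fixes f g :: "'a \<Rightarrow> real"
  assumes fg: "integrable M f" "integrable M g" "\<And>x. 0 \<le> f x" "\<And>x. 0 \<le> g x"
    and "0 \<le> t" "t \<le> 1"
  shows "(\<integral>x. f x powr t * g x powr (1 - t) \<partial>M)
    \<le> (\<integral>x. f x \<partial>M) powr t * (\<integral>x. g x \<partial>M) powr (1 - t)"
  using Holder_integral_prod[of "UNIV :: bool set" "\<lambda>b. if b then t else 1 - t" M
      "\<lambda>b. if b then f else g"] assms
  by (auto simp: UNIV_bool mult.commute split: if_splits)

section \<open>The grid inequality on product spaces\<close>

context product_sigma_finite
begin

text \<open>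
  If the box has finite measure, functions of this kind are integrable, and the class is stable under
  integrating out one coordinate and under the products of powers of line integrals that occur. The
  bounds are demanded for all arguments, not only for points of the product space, so that they
  survive any update of a coordinate.
\<close>

definition bounded_in_box :: "'i set \<Rightarrow> ('i \<Rightarrow> 'a set) \<Rightarrow> real \<Rightarrow> (('i \<Rightarrow> 'a) \<Rightarrow> real) \<Rightarrow> bool" where
  "bounded_in_box I A B f \<longleftrightarrow> f \<in> borel_measurable (PiM I M) \<and>
     (\<forall>x. 0 \<le> f x \<and> f x \<le> B) \<and> (\<forall>x. (\<exists>i\<in>I. x i \<notin> A i) \<longrightarrow> f x = 0)"

lemma integral_le_bound:
  fixes h :: "'a \<Rightarrow> real"
  assumes "S \<in> fmeasurable (M j)" "\<And>t. h t \<le> B" "0 \<le> B" "\<And>t. t \<notin> S \<Longrightarrow> h t = 0"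
  shows "(\<integral>t. h t \<partial>M j) \<le> B * measure (M j) S"
proof -
  have "(\<integral>t. h t \<partial>M j) \<le> (\<integral>t. B * indicator S t \<partial>M j)"
  proof (rule integral_mono')
    show "integrable (M j) (\<lambda>t. B * indicator S t)"
      using assms(1) by (auto simp: fmeasurable_def)
  qed (use assms in \<open>auto simp: indicator_def\<close>)
  also have "\<dots> = B * measure (M j) S"
    using assms(1) by (simp add: fmeasurableD sets.Int_space_eq2)
  finally show ?thesis .
qed

lemma integrable_bounded_in_box:
  assumes I: "finite I" and A: "\<And>i. i \<in> I \<Longrightarrow> A i \<in> fmeasurable (M i)"
    and f: "bounded_in_box I A B f"
  shows "integrable (PiM I M) f"
proof (rule Bochner_Integration.integrable_bound)
  have "emeasure (M i) (A i) \<noteq> top" if "i \<in> I" for i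
    using fmeasurableD2[OF A[OF that]] by simp
  moreover have "emeasure (PiM I M) (PiE I A) = (\<Prod>i\<in>I. emeasure (M i) (A i))"
    using I A by (intro emeasure_PiM) (auto dest: fmeasurableD)
  ultimately have "emeasure (PiM I M) (PiE I A) < \<infinity>"
    by (simp add: less_top[symmetric] ennreal_prod_eq_top)
  then show "integrable (PiM I M) (\<lambda>x. B * indicator (PiE I A) x)"
    using I A by (intro integrable_mult_right integrable_real_indicator sets_PiM_I_finite)
      (auto dest: fmeasurableD)
  show "f \<in> borel_measurable (PiM I M)"
    using f by (simp add: bounded_in_box_def)
  have "norm (f x) \<le> norm (B * indicator (PiE I A) x)" if "x \<in> space (PiM I M)" for x
    using f that unfolding bounded_in_box_def space_PiM PiE_iff
    by (cases "x \<in> PiE I A") (auto simp: PiE_iff intro: order_trans[OF _ abs_ge_self])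
  then show "AE x in PiM I M. norm (f x) \<le> norm (B * indicator (PiE I A) x)"
    by (rule AE_I2)
qed

lemma measurable_marginal:
  fixes f :: "_ \<Rightarrow> real"
  assumes [measurable]: "f \<in> borel_measurable (PiM (insert j I) M)"
  shows "(\<lambda>x. \<integral>t. f (x(j := t)) \<partial>M j) \<in> borel_measurable (PiM I M)"
proof (rule sigma_finite_measure.borel_measurable_lebesgue_integral[OF sigma_finite_measures,
    where f = "\<lambda>x t. f (x(j := t))"])
  show "(\<lambda>(x, t). f (x(j := t))) \<in> borel_measurable (PiM I M \<Otimes>\<^sub>M M j)"
    by measurable
qed

text \<open>
  A line integral of \<open>f\<close> need not vanish outside the box, but the factor \<open>f x powr e\<close> does, even for
  \<open>e = 0\<close>.
\<close>

lemma grid_integrand_bounded_in_box: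
  assumes I: "finite I" and A: "\<And>i. i \<in> I \<Longrightarrow> A i \<in> fmeasurable (M i)"
    and f: "bounded_in_box I A B f" and "0 \<le> e" "0 \<le> p"
  shows "bounded_in_box I A (B powr e * (\<Prod>j\<in>I. (B * measure (M j) (A j)) powr p))
    (\<lambda>x. f x powr e * (\<Prod>j\<in>I. (\<integral>t. f (x(j := t)) \<partial>M j) powr p))"
proof -
  have [measurable]: "f \<in> borel_measurable (PiM I M)"
    and bd: "0 \<le> f x" "f x \<le> B" and out: "i \<in> I \<Longrightarrow> x i \<notin> A i \<Longrightarrow> f x = 0" for x i
    using f by (auto simp: bounded_in_box_def)
  have "0 \<le> B" using bd[of undefined] by linarith
  have [measurable]: "(\<lambda>x. \<integral>t. f (x(j := t)) \<partial>M j) \<in> borel_measurable (PiM I M)" if "j \<in> I" for j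
    using that by (intro measurable_marginal) (simp add: insert_absorb)
  have m: "(\<integral>t. f (x(j := t)) \<partial>M j) \<le> B * measure (M j) (A j)" if "j \<in> I" for x j
    using A[OF that] bd \<open>0 \<le> B\<close> out that by (intro integral_le_bound) auto
  show ?thesis
    unfolding bounded_in_box_def
  proof (intro conjI allI impI)
    show "(\<lambda>x. f x powr e * (\<Prod>j\<in>I. (\<integral>t. f (x(j := t)) \<partial>M j) powr p)) \<in> borel_measurable (PiM I M)"
      by measurable
  qed (use bd m out assms in \<open>auto intro!: mult_nonneg_nonneg prod_nonneg mult_mono prod_mono powr_mono2\<close>)
qed

text \<open>
  An inequality of Loomis-Whitney type; Gagliardo's proof of the Sobolev inequality uses it for
  \<open>p = 1 / (card I - 1)\<close>. The power of \<open>f\<close> in the integrand, which is \<open>0\<close> for that choice, is what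
  makes induction on \<open>I\<close> possible. To add a coordinate \<open>i\<close>, integrate over \<open>i\<close> first: the line
  integral \<open>F\<close> of \<open>f\<close> in direction \<open>i\<close> is constant there, and the exponents of the other
  factors sum to 1, so the Hoelder inequality replaces each of them by its integral over \<open>i\<close>. The
  result is the same integrand built from \<open>F\<close>, in one dimension less.
\<close>

lemma grid_inequality:
  assumes "finite I" and "\<And>i. i \<in> I \<Longrightarrow> A i \<in> fmeasurable (M i)"
    and "bounded_in_box I A B f" and "0 \<le> p" "(real (card I) - 1) * p \<le> 1"
  shows "(\<integral>x. f x powr (1 - (real (card I) - 1) * p) * (\<Prod>j\<in>I. (\<integral>t. f (x(j := t)) \<partial>M j) powr p) \<partial>PiM I M)
    \<le> (\<integral>x. f x \<partial>PiM I M) powr (1 + p)"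
  using assms
proof (induction I arbitrary: f B rule: finite_induct)
  case empty
  have [simp]: "(\<integral>x. h x \<partial>PiM {} M) = h (\<lambda>_. undefined)" for h :: "_ \<Rightarrow> real"
    by (simp add: PiM_empty lebesgue_integral_count_space_finite)
  show ?case by simp
next
  case (insert i I)
  note A = insert.prems(1)
  have [measurable]: "f \<in> borel_measurable (PiM (insert i I) M)"
    and bd: "0 \<le> f x" "f x \<le> B" and out: "j \<in> insert i I \<Longrightarrow> x j \<notin> A j \<Longrightarrow> f x = 0" for x j
    using insert.prems by (auto simp: bounded_in_box_def)
  have B: "0 \<le> B" using bd[of undefined] by linarith
  define n where "n = real (card I)"
  have n: "real (card (insert i I)) - 1 = n" "n * p \<le> 1"
    using insert by (auto simp: n_def)
  have np: "(n - 1) * p \<le> 1"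
    using n(2) insert.prems(3) by (simp add: algebra_simps)
  define F where "F x = (\<integral>y. f (x(i := y)) \<partial>M i)" for x
  define G where "G j x = (\<integral>t. f (x(j := t)) \<partial>M j)" for j x
  have Gi: "G i (x(i := y)) = F x" for x y
    by (simp add: G_def F_def)
  have G0: "0 \<le> G j x" for j x
    using bd by (simp add: G_def)
  have GB: "G j x \<le> B * measure (M j) (A j)" if "j \<in> insert i I" for j x
    unfolding G_def using A[OF that] bd B out that by (intro integral_le_bound) auto
  have Gm [measurable]: "G j \<in> borel_measurable (PiM (insert i I) M)" if "j \<in> insert i I" for j
    unfolding G_def using that by (intro measurable_marginal) (simp add: insert_absorb)
  have F: "bounded_in_box I A (B * measure (M i) (A i)) F"
    unfolding bounded_in_box_def
  proof (intro conjI allI impI)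
    show "F \<in> borel_measurable (PiM I M)"
      unfolding F_def by (rule measurable_marginal) measurable
    show "0 \<le> F x" for x using bd by (simp add: F_def)
    show "F x \<le> B * measure (M i) (A i)" for x
      using GB[of i x] by (simp add: F_def G_def)
    show "F x = 0" if ex: "\<exists>j\<in>I. x j \<notin> A j" for x
    proof -
      obtain j where "j \<in> I" "x j \<notin> A j" using ex by auto
      then have "f (x(i := y)) = 0" for y
        using insert.hyps by (intro out[of j]) auto
      then show ?thesis by (simp add: F_def)
    qed
  qed
  define H where "H x = f x powr (1 - n * p) * (\<Prod>j\<in>insert i I. G j x powr p)" for x
  have "integrable (PiM (insert i I) M) H"
    unfolding H_def G_def
    by (rule integrable_bounded_in_box[OF _ A grid_integrand_bounded_in_box[OF _ A insert.prems(2)]])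
      (use insert n in auto)
  then have "(\<integral>x. H x \<partial>PiM (insert i I) M) = (\<integral>x. (\<integral>y. H (x(i := y)) \<partial>M i) \<partial>PiM I M)"
    using insert.hyps by (intro product_integral_insert)
  also have "\<dots> \<le> (\<integral>x. F x powr (1 - (n - 1) * p) * (\<Prod>j\<in>I. (\<integral>t. F (x(j := t)) \<partial>M j) powr p) \<partial>PiM I M)"
  proof (rule integral_mono')
    show "integrable (PiM I M) (\<lambda>x. F x powr (1 - (n - 1) * p) * (\<Prod>j\<in>I. (\<integral>t. F (x(j := t)) \<partial>M j) powr p))"
      by (rule integrable_bounded_in_box[OF _ A grid_integrand_bounded_in_box[OF _ A F]])
        (use insert np in auto)
  next
    fix x assume x: "x \<in> space (PiM I M)"
    note [measurable] = measurable_component_update[OF x insert.hyps(2)]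
    have supp: "integrable (M i) h" if "h \<in> borel_measurable (M i)" "\<And>y. 0 \<le> h y" "\<And>y. h y \<le> D"
      "\<And>y. y \<notin> A i \<Longrightarrow> h y = 0" for h and D :: real
    proof (rule Bochner_Integration.integrable_bound)
      show "integrable (M i) (\<lambda>y. D * indicator (A i) y)"
        using A[of i] by (auto simp: fmeasurable_def)
      show "AE y in M i. norm (h y) \<le> norm (D * indicator (A i) y)"
        using that by (intro AE_I2) (auto simp: indicator_def intro: order_trans[OF _ abs_ge_self])
    qed fact
    \<comment> \<open>The index \<open>i\<close> is reused for the power of \<open>f\<close> itself.\<close>
    define g where "g j y = (if j = i then f (x(i := y)) else G j (x(i := y)))" for j y
    have "(\<integral>y. H (x(i := y)) \<partial>M i)
      = F x powr p * (\<integral>y. (\<Prod>j\<in>insert i I. g j y powr (if j = i then 1 - n * p else p)) \<partial>M i)"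
    proof -
      have "(\<Prod>j\<in>I. g j y powr (if j = i then 1 - n * p else p)) = (\<Prod>j\<in>I. G j (x(i := y)) powr p)" for y
        using insert.hyps by (intro prod.cong) (auto simp: g_def)
      then show ?thesis
        using insert.hyps by (simp add: H_def Gi g_def mult_ac del: fun_upd_apply)
    qed
    also have "\<dots> \<le> F x powr p *
      (\<Prod>j\<in>insert i I. (\<integral>y. g j y \<partial>M i) powr (if j = i then 1 - n * p else p))"
    proof (intro mult_left_mono Holder_integral_prod)
      show "(\<Sum>j\<in>insert i I. if j = i then 1 - n * p else p) = 1"
      proof -
        have "(\<Sum>j\<in>I. if j = i then 1 - n * p else p) = (\<Sum>j\<in>I. p)"
          using insert.hyps by (intro sum.cong) auto
        then show ?thesis using insert.hyps by (simp add: n_def)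
      qed
      show "integrable (M i) (g j)" if j: "j \<in> insert i I" for j
      proof (rule supp)
        show "g j \<in> borel_measurable (M i)"
          using j unfolding g_def by (cases "j = i") simp_all
        show "0 \<le> g j y" for y
          using bd G0 by (simp add: g_def)
        show "g j y \<le> max B (B * measure (M j) (A j))" for y
          using bd GB[OF j] by (simp add: g_def le_max_iff_disj)
        show "g j y = 0" if y: "y \<notin> A i" for y
        proof -
          have "f (x(i := y, j := t)) = 0" if "j \<noteq> i" for t
            using y that by (intro out[of i]) auto
          moreover have "f (x(i := y)) = 0"
            using y by (intro out[of i]) auto
          ultimately show ?thesis by (simp add: g_def G_def)
        qed
      qed
    qed (use insert n bd G0 in \<open>auto simp: g_def\<close>)
    also have "\<dots> = F x powr p * (F x powr (1 - n * p) *
        (\<Prod>j\<in>I. (\<integral>t. F (x(j := t)) \<partial>M j) powr p))"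
    proof -
      have "(\<integral>y. g j y \<partial>M i) = (\<integral>t. F (x(j := t)) \<partial>M j)" if j: "j \<in> I" for j
      proof -
        have ij: "j \<noteq> i" using j insert.hyps by auto
        interpret ji: pair_sigma_finite "M j" "M i"
          by (simp add: pair_sigma_finite_def sigma_finite_measures)
        have upd: "(\<lambda>z. x(i := snd z, j := fst z)) \<in> measurable (M j \<Otimes>\<^sub>M M i) (PiM (insert i I) M)"
        proof (rule measurable_fun_upd[where J = "insert i I"])
          show "(\<lambda>z. x(i := snd z)) \<in> measurable (M j \<Otimes>\<^sub>M M i) (PiM (insert i I) M)"
            by (rule measurable_fun_upd[where J = I]) (use x in auto)
        qed (use j in auto)
        have int: "integrable (M j \<Otimes>\<^sub>M M i) (\<lambda>(t, y). f (x(i := y, j := t)))"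
        proof (rule Bochner_Integration.integrable_bound)
          have "emeasure (M j \<Otimes>\<^sub>M M i) (A j \<times> A i) < \<infinity>"
            using A[of i] A[of j] j
            by (simp add: sigma_finite_measure.emeasure_pair_measure_Times[OF sigma_finite_measures] fmeasurable_def ennreal_mult_less_top)
          then show "integrable (M j \<Otimes>\<^sub>M M i) (\<lambda>z. B * indicator (A j \<times> A i) z)"
            using A[of i] A[of j] j by (auto simp: fmeasurableD)
          show "(\<lambda>(t, y). f (x(i := y, j := t))) \<in> borel_measurable (M j \<Otimes>\<^sub>M M i)"
            using measurable_compose[OF upd, of f borel] by (simp add: case_prod_beta)
          have "norm (f (x(i := y, j := t))) \<le> norm (B * indicator (A j \<times> A i) (t, y))" for t y
          proof (cases "t \<in> A j \<and> y \<in> A i")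
            case True
            then show ?thesis using bd B by simp
          next
            case False
            then have "f (x(i := y, j := t)) = 0"
              using j ij out[of i "x(i := y, j := t)"] out[of j "x(i := y, j := t)"] by auto
            then show ?thesis by simp
          qed
          then show "AE z in M j \<Otimes>\<^sub>M M i. norm (case z of (t, y) \<Rightarrow> f (x(i := y, j := t)))
              \<le> norm (B * indicator (A j \<times> A i) z)"
            by (intro AE_I2) (simp only: split_paired_all split_conv)
        qed
        have "(\<integral>y. g j y \<partial>M i) = (\<integral>y. (\<integral>t. f (x(i := y, j := t)) \<partial>M j) \<partial>M i)"
          using ij by (simp add: g_def G_def)
        also have "\<dots> = (\<integral>t. (\<integral>y. f (x(i := y, j := t)) \<partial>M i) \<partial>M j)"
          by (rule ji.Fubini_integral[OF int])
        also have "\<dots> = (\<integral>t. F (x(j := t)) \<partial>M j)"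
          using ij by (simp add: F_def fun_upd_twist)
        finally show ?thesis .
      qed
      moreover have "(\<integral>y. g i y \<partial>M i) = F x"
        by (simp add: g_def F_def)
      moreover have "(\<Prod>j\<in>I. (\<integral>y. g j y \<partial>M i) powr (if j = i then 1 - n * p else p))
        = (\<Prod>j\<in>I. (\<integral>y. g j y \<partial>M i) powr p)"
        using insert.hyps by (intro prod.cong) auto
      ultimately show ?thesis
        using insert.hyps by simp
    qed
    also have "\<dots> = F x powr (1 - (n - 1) * p) * (\<Prod>j\<in>I. (\<integral>t. F (x(j := t)) \<partial>M j) powr p)"
      by (simp add: powr_add[symmetric] mult.assoc[symmetric] algebra_simps)
    finally show "(\<integral>y. H (x(i := y)) \<partial>M i)
      \<le> F x powr (1 - (n - 1) * p) * (\<Prod>j\<in>I. (\<integral>t. F (x(j := t)) \<partial>M j) powr p)" .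
    show "0 \<le> F x powr (1 - (n - 1) * p) * (\<Prod>j\<in>I. (\<integral>t. F (x(j := t)) \<partial>M j) powr p)"
      by (intro mult_nonneg_nonneg prod_nonneg) auto
  qed
  also have "\<dots> \<le> (\<integral>x. F x \<partial>PiM I M) powr (1 + p)"
    unfolding n_def by (rule insert.IH[OF A F insert.prems(3) np[unfolded n_def]]) auto
  also have "(\<integral>x. F x \<partial>PiM I M) = (\<integral>x. f x \<partial>PiM (insert i I) M)"
    unfolding F_def using insert
    by (intro product_integral_insert[symmetric] integrable_bounded_in_box[where A = A and B = B]) auto
  finally show ?case
    by (simp only: H_def G_def n)
qed

end

section \<open>The Sobolev inequality for \<open>L\<^sup>1\<close> gradients\<close>

text \<open>
  A comparison of derivatives rather than the fundamental theorem of calculus, so that \<open>\<phi>'\<close> may be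
  any pointwise derivative, integrable or not.
\<close>

lemma norm_le_integral_of_derivative_bound:
  fixes \<phi> :: "real \<Rightarrow> 'b::real_normed_vector" and \<gamma> :: "real \<Rightarrow> real"
  assumes \<phi>: "\<And>t. (\<phi> has_vector_derivative \<phi>' t) (at t)" "\<And>t. norm (\<phi>' t) \<le> \<gamma> t"
    and \<gamma>: "continuous_on UNIV \<gamma>" "integrable lborel \<gamma>"
    and "\<phi> a = 0" "a < s"
  shows "norm (\<phi> s) \<le> (\<integral>t. \<gamma> t \<partial>lborel)"
proof -
  have \<gamma>0: "0 \<le> \<gamma> t" for t
    using \<phi>(2)[of t] norm_ge_zero order_trans by blast
  have c: "continuous_on {a..s} \<gamma>"
    using \<gamma>(1) continuous_on_subset by blast
  define \<Gamma> where "\<Gamma> u = integral {a..u} \<gamma>" for u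
  have \<Gamma>': "(\<Gamma> has_vector_derivative \<gamma> t) (at t within {a..s})" if "t \<in> {a..s}" for t
    unfolding \<Gamma>_def by (rule integral_has_vector_derivative[OF c that])
  have "norm (\<phi> s - \<phi> a) \<le> \<Gamma> s - \<Gamma> a"
  proof (rule differentiable_bound_general[OF \<open>a < s\<close> _ _ \<phi>(1) _ \<phi>(2)])
    show "continuous_on {a..s} \<phi>"
      by (meson \<phi>(1) continuous_at_imp_continuous_on has_vector_derivative_continuous)
    show "continuous_on {a..s} \<Gamma>"
      using \<Gamma>' has_vector_derivative_continuous continuous_on_eq_continuous_within by blast
    show "(\<Gamma> has_vector_derivative \<gamma> t) (at t)" if "a < t" "t < s" for t
      using \<Gamma>'[of t] that by (simp add: at_within_Icc_at)
  qed
  also have "\<Gamma> a = 0" by (simp add: \<Gamma>_def)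
  also have "\<Gamma> s = (\<integral>t. indicator {a..s} t *\<^sub>R \<gamma> t \<partial>lborel)"
    using set_borel_integral_eq_integral(2)[OF borel_integrable_atLeastAtMost'[OF c]]
    by (simp add: \<Gamma>_def set_lebesgue_integral_def)
  also have "\<dots> \<le> (\<integral>t. \<gamma> t \<partial>lborel)"
    by (rule integral_mono'[OF \<gamma>(2)]) (use \<gamma>0 in \<open>auto simp: indicator_def\<close>)
  finally show ?thesis using \<open>\<phi> a = 0\<close> by simp
qed

lemma integrable_continuous_compact_support:
  fixes h :: "'a::euclidean_space \<Rightarrow> 'b::{banach, second_countable_topology}"
  assumes "continuous_on UNIV h" "\<And>x. norm x > N \<Longrightarrow> h x = 0"
  shows "integrable lborel h"
proof -
  have "integrable lborel (\<lambda>x. indicator (cball 0 N) x *\<^sub>R h x)"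
    by (rule borel_integrable_compact) (use assms(1) continuous_on_subset in auto)
  also have "(\<lambda>x. indicator (cball 0 N) x *\<^sub>R h x) = h"
    using assms(2) by (auto simp: indicator_def fun_eq_iff not_le)
  finally show ?thesis .
qed

text \<open>
  The function \<open>g\<close> stands for an integrable majorant of the partial derivatives. In the grid
  inequality with \<open>p = 1 / (d - 1)\<close> the factor \<open>g powr 0\<close> is the indicator of \<open>g \<noteq> 0\<close>, whereas a
  factor 1 is wanted wherever \<open>f \<noteq> 0\<close>. So \<open>g\<close> is first raised by \<open>\<epsilon>\<close> on a cube \<open>Q\<close> containing the
  supports, and then \<open>\<epsilon>\<close> tends to 0.
\<close>

lemma Gagliardo_Nirenberg_Sobolev:
  fixes f g :: "'a::euclidean_space \<Rightarrow> real"
  assumes d: "DIM('a) \<ge> 2"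
    and f': "\<And>x. (f has_derivative f' x) (at x)"
    and bound: "\<And>x b. b \<in> Basis \<Longrightarrow> \<bar>f' x b\<bar> \<le> g x"
    and g: "continuous_on UNIV g"
    and supp: "\<And>x. norm x > N \<Longrightarrow> f x = 0" "\<And>x. norm x > N \<Longrightarrow> g x = 0"
  shows "(\<integral>x. \<bar>f x\<bar> powr (real DIM('a) / (real DIM('a) - 1)) \<partial>lborel)
    \<le> (\<integral>x. g x \<partial>lborel) powr (real DIM('a) / (real DIM('a) - 1))"
proof -
  define p where "p = 1 / (real DIM('a) - 1)"
  have p: "p > 0" "(real DIM('a) - 1) * p = 1" "p * real DIM('a) = 1 + p"
    "real DIM('a) / (real DIM('a) - 1) = 1 + p"
    using d by (auto simp: p_def field_simps)
  interpret product_sigma_finite "\<lambda>_::'a. lborel :: real measure"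
    by standard
  define S where "S = {-N..N}"
  define Q :: "'a set" where "Q = {x. \<forall>b\<in>Basis. x \<bullet> b \<in> S}"
  have Q_cbox: "Q = cbox (\<Sum>b\<in>Basis. (-N) *\<^sub>R b) (\<Sum>b\<in>Basis. N *\<^sub>R b)"
    by (auto simp: Q_def S_def mem_box inner_sum_left_Basis simp del: scaleR_minus_left)
  have Qm [measurable]: "Q \<in> sets borel" and Qfin: "emeasure lborel Q < \<infinity>"
    by (simp_all only: Q_cbox emeasure_lborel_cbox_finite borel_closed closed_cbox)
  have supp': "f x = 0" "g x = 0" if xQ: "x \<notin> Q" for x
  proof -
    obtain b where "b \<in> Basis" "x \<bullet> b \<notin> S"
      using xQ by (auto simp: Q_def)
    then have "norm x > N"
      using Basis_le_norm[of b x] by (auto simp: S_def)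
    then show "f x = 0" "g x = 0" using supp by auto
  qed
  have g0: "0 \<le> g x" for x
    using bound[OF SOME_Basis, of x] abs_ge_zero order_trans by blast
  obtain B where B: "\<And>x. g x \<le> B"
  proof -
    have "bounded (g ` cbox (\<Sum>b\<in>Basis. (-N) *\<^sub>R b) (\<Sum>b\<in>Basis. N *\<^sub>R b))"
      by (intro compact_imp_bounded compact_continuous_image continuous_on_subset[OF g]) auto
    then obtain B where "\<And>x. x \<in> Q \<Longrightarrow> \<bar>g x\<bar> \<le> B"
      unfolding bounded_iff Q_cbox by auto
    then have "g x \<le> max B 0" for x
      using supp'(2)[of x] by (cases "x \<in> Q") (force simp: le_max_iff_disj)+
    then show ?thesis by (rule that)
  qed
  have [measurable]: "g \<in> borel_measurable borel"
    using g by (rule borel_measurable_continuous_onI)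
  have fc: "continuous_on UNIV f"
    using f' has_derivative_continuous continuous_at_imp_continuous_on by blast
  then have [measurable]: "f \<in> borel_measurable borel"
    by (rule borel_measurable_continuous_onI)
  have gint: "integrable lborel g"
    using g supp(2) by (rule integrable_continuous_compact_support)
  define E where "E x = (\<Sum>b\<in>Basis. x b *\<^sub>R b)" for x :: "'a \<Rightarrow> real"
  have E_inner: "E x \<bullet> b = x b" if "b \<in> Basis" for x b
    using that by (simp add: E_def inner_sum_left_Basis)
  have E_upd: "E (x(b := t)) = E x + (t - x b) *\<^sub>R b" if "b \<in> Basis" for x b t
  proof (rule euclidean_eqI)
    fix c :: 'a assume "c \<in> Basis"
    then show "E (x(b := t)) \<bullet> c = (E x + (t - x b) *\<^sub>R b) \<bullet> c"
      using that by (cases "c = b") (simp_all add: E_inner inner_add_left inner_not_same_Basis)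
  qed
  have [measurable]: "E \<in> borel_measurable (PiM Basis (\<lambda>_. lborel))"
    unfolding E_def by measurable
  have lborel_E: "(\<integral>x. h x \<partial>lborel) = (\<integral>x. h (E x) \<partial>PiM Basis (\<lambda>_. lborel))"
    if "h \<in> borel_measurable borel" for h :: "'a \<Rightarrow> real"
    unfolding E_def by (subst lborel_eq, subst integral_distr) (use that in auto)
  have key: "(\<integral>x. \<bar>f x\<bar> powr (1 + p) \<partial>lborel) \<le> ((\<integral>x. g x \<partial>lborel) + \<epsilon> * measure lborel Q) powr (1 + p)"
    if \<epsilon>: "\<epsilon> > 0" for \<epsilon>
  proof -
    define G where "G x = g x + \<epsilon> * indicator Q x" for x
    have [measurable]: "G \<in> borel_measurable borel"
      unfolding G_def by measurable
    have Gbox: "bounded_in_box Basis (\<lambda>_. S) (B + \<epsilon>) (\<lambda>x. G (E x))"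
      unfolding bounded_in_box_def
    proof (intro conjI allI impI)
      show "0 \<le> G (E x)" "G (E x) \<le> B + \<epsilon>" for x
        using g0 B \<epsilon> by (auto simp: G_def indicator_def intro: add_mono add_nonneg_nonneg add_increasing2)
      show "G (E x) = 0" if "\<exists>b\<in>Basis. x b \<notin> S" for x
      proof -
        have "E x \<notin> Q" using that by (auto simp: Q_def E_inner)
        then show ?thesis using supp' by (simp add: G_def)
      qed
    qed measurable
    have line: "\<bar>f (E x)\<bar> \<le> (\<integral>t. G (E (x(b := t))) \<partial>lborel)" if b: "b \<in> Basis" for x b
    proof (cases "E x \<in> Q")
      case False
      then show ?thesis using supp'(1) g0 \<epsilon> by (simp add: G_def)
    next
      case True
      define l where "l t = E x + (t - x b) *\<^sub>R b" for t
      have l: "(l has_vector_derivative b) (at t)" for t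
        unfolding l_def by (auto intro!: derivative_eq_intros)
      have lQ: "t \<in> S" if "l t \<in> Q" for t
        using that b by (auto simp: Q_def l_def E_inner inner_add_left inner_Basis)
      have lc: "continuous_on UNIV l"
        unfolding l_def by (intro continuous_intros)
      have \<gamma>c: "continuous_on UNIV (\<lambda>t. g (l t))"
        by (rule continuous_on_compose2[OF g lc]) auto
      have [measurable]: "l \<in> borel_measurable borel"
        using lc by (rule borel_measurable_continuous_onI)
      \<comment> \<open>A point of the line just outside the cube, where the integration can start.\<close>
      have "\<bar>f (l t)\<bar> = 0" if "t = - N - 1" for t
        using supp'(1)[of "l t"] lQ[of t] that by (auto simp: S_def)
      then have l0: "f (l (- N - 1)) = 0" by simp
      have \<gamma>i: "integrable lborel (\<lambda>t. g (l t))"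
      proof (rule integrable_continuous_compact_support[OF \<gamma>c])
        show "g (l t) = 0" if "norm t > N" for t
          using that lQ[of t] supp'(2)[of "l t"] by (force simp: S_def)
      qed
      have "- N - 1 < x b"
        using True b by (auto simp: Q_def S_def E_inner)
      have "norm (f (l (x b))) \<le> (\<integral>t. g (l t) \<partial>lborel)"
      proof (rule norm_le_integral_of_derivative_bound[where \<phi> = "\<lambda>t. f (l t)"
            and \<phi>' = "\<lambda>t. f' (l t) b", OF _ _ \<gamma>c \<gamma>i l0 \<open>- N - 1 < x b\<close>])
        show "((\<lambda>t. f (l t)) has_vector_derivative f' (l t) b) (at t)" for t
          using vector_derivative_diff_chain_within[of l b t UNIV f "f' (l t)"] l f'
          by (simp add: o_def has_derivative_at_withinI)
        show "norm (f' (l t) b) \<le> g (l t)" for t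
          using bound[OF b] by simp
      qed
      also have "\<dots> \<le> (\<integral>t. G (l t) \<partial>lborel)"
      proof (rule integral_mono'[OF _ _])
        have "integrable lborel (\<lambda>t. \<epsilon> * indicator Q (l t))"
        proof (rule Bochner_Integration.integrable_bound)
          show "integrable lborel (\<lambda>t. \<epsilon> * indicator S t)"
            by (simp add: S_def emeasure_lborel_Icc_eq)
          show "AE t in lborel. norm (\<epsilon> * indicator Q (l t)) \<le> norm (\<epsilon> * indicator S t)"
            using lQ by (intro AE_I2) (auto simp: indicator_def)
        qed measurable
        then show "integrable lborel (\<lambda>t. G (l t))"
          unfolding G_def by (intro Bochner_Integration.integrable_add \<gamma>i)
      qed (use \<epsilon> g0 in \<open>auto simp: G_def\<close>)
      finally show ?thesis
        using b by (simp add: E_upd l_def)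
    qed
    have "(\<integral>x. \<bar>f x\<bar> powr (1 + p) \<partial>lborel)
        = (\<integral>x. \<bar>f (E x)\<bar> powr (1 + p) \<partial>PiM Basis (\<lambda>_. lborel))"
      by (rule lborel_E) measurable
    also have "\<dots> \<le> (\<integral>x. G (E x) powr (1 - (real DIM('a) - 1) * p) *
        (\<Prod>b\<in>Basis. (\<integral>t. G (E (x(b := t))) \<partial>lborel) powr p) \<partial>PiM Basis (\<lambda>_. lborel))"
    proof (rule integral_mono')
      show "integrable (PiM Basis (\<lambda>_. lborel)) (\<lambda>x. G (E x) powr (1 - (real DIM('a) - 1) * p) *
        (\<Prod>b\<in>Basis. (\<integral>t. G (E (x(b := t))) \<partial>lborel) powr p))"
        by (rule integrable_bounded_in_box[OF _ _ grid_integrand_bounded_in_box[OF _ _ Gbox]])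
          (use p in \<open>auto simp: S_def fmeasurable_def emeasure_lborel_Icc_eq\<close>)
    next
      fix x
      show "\<bar>f (E x)\<bar> powr (1 + p) \<le> G (E x) powr (1 - (real DIM('a) - 1) * p) *
        (\<Prod>b\<in>Basis. (\<integral>t. G (E (x(b := t))) \<partial>lborel) powr p)"
      proof (cases "E x \<in> Q")
        case False
        then show ?thesis using supp'(1) by (simp add: prod_nonneg)
      next
        case True
        then have "G (E x) > 0" using g0[of "E x"] \<epsilon> by (simp add: G_def)
        then have [simp]: "G (E x) powr (1 - (real DIM('a) - 1) * p) = 1"
          using p by simp
        have "\<bar>f (E x)\<bar> powr (1 + p) = (\<Prod>b\<in>(Basis::'a set). \<bar>f (E x)\<bar> powr p)"
          using d by (cases "f (E x) = 0")
            (simp_all add: p(3)[symmetric] powr_powr[symmetric] powr_realpow)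
        also have "\<dots> \<le> (\<Prod>b\<in>Basis. (\<integral>t. G (E (x(b := t))) \<partial>lborel) powr p)"
          using line p by (intro prod_mono conjI powr_mono2) auto
        finally show ?thesis by simp
      qed
    qed (auto intro!: mult_nonneg_nonneg prod_nonneg)
    also have "\<dots> \<le> (\<integral>x. G (E x) \<partial>PiM Basis (\<lambda>_. lborel)) powr (1 + p)"
      by (rule grid_inequality[OF _ _ Gbox])
        (use p in \<open>auto simp: S_def fmeasurable_def emeasure_lborel_Icc_eq\<close>)
    also have "(\<integral>x. G (E x) \<partial>PiM Basis (\<lambda>_. lborel)) = (\<integral>x. G x \<partial>lborel)"
      by (rule lborel_E[symmetric]) measurable
    also have "\<dots> = (\<integral>x. g x \<partial>lborel) + \<epsilon> * measure lborel Q"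
      unfolding G_def using gint Qfin by (subst Bochner_Integration.integral_add) auto
    finally show ?thesis .
  qed
  have "((\<lambda>\<epsilon>. ((\<integral>x. g x \<partial>lborel) + \<epsilon> * measure lborel Q) powr (1 + p)) \<longlongrightarrow>
      ((\<integral>x. g x \<partial>lborel) + 0 * measure lborel Q) powr (1 + p)) (at_right 0)"
  proof (rule tendsto_powr')
    show "(\<integral>x. g x \<partial>lborel) + 0 * measure lborel Q \<noteq> 0 \<or> 0 < 1 + p \<and>
        (\<forall>\<^sub>F \<epsilon> in at_right 0. 0 \<le> (\<integral>x. g x \<partial>lborel) + \<epsilon> * measure lborel Q)"
      using p g0 by (auto simp: eventually_at_right_field intro!: exI[of _ 1])
  qed (intro tendsto_intros)+
  then have "(\<integral>x. \<bar>f x\<bar> powr (1 + p) \<partial>lborel) \<le> ((\<integral>x. g x \<partial>lborel) + 0 * measure lborel Q) powr (1 + p)"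
    by (rule tendsto_lowerbound) (use key in \<open>auto simp: eventually_at_right_field intro!: exI[of _ 1]\<close>)
  then show ?thesis using p by simp
qed

section \<open>Weighted estimates on the hyperboloid\<close>

text \<open>
  For \<open>p > 1\<close> the power of the norm is differentiable at \<open>0\<close> as well, with derivative \<open>0\<close>; the
  conventions \<open>sgn 0 = 0\<close> and \<open>0 powr (p - 1) = 0\<close> let one formula cover both cases.
\<close>

lemma has_derivative_norm_powr:
  fixes x :: "'b::real_inner"
  assumes "p > 1"
  shows "((\<lambda>y. norm y powr p) has_derivative (\<lambda>h. p * norm x powr (p - 1) * (sgn x \<bullet> h))) (at x)"
proof (cases "x = 0")
  case True
  have "((\<lambda>y. norm (norm y powr p - norm x powr p - 0) / norm (y - x)) \<longlongrightarrow> 0) (at x)"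
  proof (rule Lim_transform_eventually)
    have "((\<lambda>y::'b. norm y) \<longlongrightarrow> 0) (at 0)"
      using tendsto_norm[OF tendsto_ident_at[of "0::'b" UNIV]] by simp
    then have "((\<lambda>y::'b. norm y powr (p - 1)) \<longlongrightarrow> 0 powr (p - 1)) (at 0)"
      using assms by (intro tendsto_powr' tendsto_const) auto
    then show "((\<lambda>y::'b. norm y powr (p - 1)) \<longlongrightarrow> 0) (at x)"
      using True by simp
    show "\<forall>\<^sub>F y in at x. norm y powr (p - 1) = norm (norm y powr p - norm x powr p - 0) / norm (y - x)"
      unfolding True by (auto simp: eventually_at powr_diff intro!: exI[of _ 1])
  qed
  then show ?thesis
    using True by (simp add: has_derivative_iff_norm)
next
  case False
  have "((\<lambda>z. z powr p) has_derivative (\<lambda>h. p * norm x powr (p - 1) * h)) (at (norm x))"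
    using has_real_derivative_powr[of "norm x" p] False
    by (simp add: has_field_derivative_def)
  from has_derivative_compose[OF has_derivative_norm[OF False] this]
  show ?thesis by (simp add: inner_commute)
qed

lemma hyp_weight_pos: "\<tau> > 0 \<Longrightarrow> hyp_weight \<tau> x > 0"
  by (simp add: hyp_weight_def add_pos_nonneg)

lemma norm_le_hyp_weight: "norm x \<le> hyp_weight \<tau> x"
  unfolding hyp_weight_def by (rule real_le_rsqrt) simp

lemma continuous_on_hyp_weight [continuous_intros]:
  "continuous_on A f \<Longrightarrow> continuous_on A (\<lambda>x. hyp_weight \<tau> (f x))"
  unfolding hyp_weight_def by (intro continuous_intros)

lemma continuous_on_hyp_weight_powr [continuous_intros]:
  "\<tau> > 0 \<Longrightarrow> continuous_on A f \<Longrightarrow> continuous_on A (\<lambda>x. hyp_weight \<tau> (f x) powr e)"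
  by (intro continuous_intros) (auto simp: hyp_weight_pos less_imp_neq[symmetric])

lemma continuous_on_norm_powr [continuous_intros]:
  fixes f :: "'a::topological_space \<Rightarrow> 'b::real_normed_vector"
  shows "e > 0 \<Longrightarrow> continuous_on A f \<Longrightarrow> continuous_on A (\<lambda>x. norm (f x) powr e)"
  by (intro continuous_on_powr') (auto intro: continuous_intros)

lemma has_derivative_hyp_weight:
  assumes "\<tau> > 0"
  shows "(hyp_weight \<tau> has_derivative (\<lambda>h. (x \<bullet> h) / hyp_weight \<tau> x)) (at x)"
proof -
  have pos: "\<tau>\<^sup>2 + x \<bullet> x > 0" by (rule add_pos_nonneg) (use assms in auto)
  have "((\<lambda>y. sqrt (\<tau>\<^sup>2 + y \<bullet> y)) has_derivative (\<lambda>h. (x \<bullet> h) / sqrt (\<tau>\<^sup>2 + x \<bullet> x))) (at x)"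
    by (rule derivative_eq_intros refl pos | simp)+ (simp add: inner_commute field_simps)
  then show ?thesis
    unfolding hyp_weight_def power2_norm_eq_inner by simp
qed

lemma has_derivative_hyp_weight_powr:
  assumes "\<tau> > 0"
  shows "((\<lambda>x. hyp_weight \<tau> x powr c) has_derivative
    (\<lambda>h. c * hyp_weight \<tau> x powr (c - 1) * ((x \<bullet> h) / hyp_weight \<tau> x))) (at x)"
proof -
  have "((\<lambda>z. z powr c) has_derivative (\<lambda>h. c * hyp_weight \<tau> x powr (c - 1) * h)) (at (hyp_weight \<tau> x))"
    using has_real_derivative_powr[OF hyp_weight_pos[OF assms], of c x]
    by (simp add: has_field_derivative_def)
  from has_derivative_compose[OF has_derivative_hyp_weight[OF assms] this]
  show ?thesis .
qed

text \<open>
  The integrals to which all norms reduce. The measure is \<open>dx\<close>, not the volume form of the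
  hyperboloid: this shifts the weight exponent by one and takes out the factor \<open>\<tau>\<close>.
\<close>

definition weighted_power_integral :: "real \<Rightarrow> real \<Rightarrow> real \<Rightarrow> (real ^ 'd \<Rightarrow> 'b::real_normed_vector) \<Rightarrow> real" where
  "weighted_power_integral \<tau> e p v = (\<integral>x. hyp_weight \<tau> x powr e * norm (v x) powr p \<partial>lborel)"

lemma weighted_power_integral_nonneg: "0 \<le> weighted_power_integral \<tau> e p v"
  by (simp add: weighted_power_integral_def)

lemma integrable_weighted_power:
  fixes v :: "real ^ 'd \<Rightarrow> 'b::real_normed_vector"
  assumes "\<tau> > 0" "p > 0" "continuous_on UNIV v" "\<And>x. norm x > N \<Longrightarrow> v x = 0"
  shows "integrable lborel (\<lambda>x. hyp_weight \<tau> x powr e * norm (v x) powr p)"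
  by (rule integrable_continuous_compact_support[where N = N])
    (use assms in \<open>auto intro!: continuous_intros\<close>)

lemma weighted_power_integral_Holder:
  fixes v :: "real ^ 'd \<Rightarrow> 'b::real_normed_vector" and h :: "real ^ 'd \<Rightarrow> 'c::real_normed_vector"
  assumes "\<tau> > 0" "p > 0" "q > 0" "0 \<le> t" "t \<le> 1"
    and v: "continuous_on UNIV v" "\<And>x. norm x > N \<Longrightarrow> v x = 0"
    and h: "continuous_on UNIV h" "\<And>x. norm x > N \<Longrightarrow> h x = 0"
  shows "(\<integral>x. hyp_weight \<tau> x powr (a * t + b * (1 - t)) *
      (norm (v x) powr (p * t) * norm (h x) powr (q * (1 - t))) \<partial>lborel)
    \<le> weighted_power_integral \<tau> a p v powr t * weighted_power_integral \<tau> b q h powr (1 - t)"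
proof -
  have "hyp_weight \<tau> x powr (a * t + b * (1 - t)) * (norm (v x) powr (p * t) * norm (h x) powr (q * (1 - t)))
    = (hyp_weight \<tau> x powr a * norm (v x) powr p) powr t *
      (hyp_weight \<tau> x powr b * norm (h x) powr q) powr (1 - t)" for x
    by (simp add: powr_mult powr_powr powr_add)
  then show ?thesis
    unfolding weighted_power_integral_def using assms
    by (simp only:) (intro Holder_integral_mult integrable_weighted_power, auto)
qed

text \<open>
  The \<open>L\<^sup>1\<close> Sobolev inequality for \<open>f = (w\<^sup>a |v|)\<^sup>p\<close>. The product rule gives two terms. In the one with
  \<open>D v\<close>, a factor \<open>w\<close> is moved to the derivative, leaving \<open>w\<^bsup>ap-1\<^esup>\<close>; in the one with \<open>D w\<close>, the bound
  \<open>|D w| \<le> 1\<close> leaves the same power of \<open>w\<close>.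
\<close>

lemma weighted_Sobolev:
  fixes v :: "real ^ 'd \<Rightarrow> 'b::real_inner" and D :: "real ^ 'd \<Rightarrow> real ^ 'd \<Rightarrow> 'b"
  defines "d \<equiv> real CARD('d)"
  assumes \<tau>: "\<tau> > 0" and d: "CARD('d) \<ge> 2" and p: "p > 1"
    and v: "\<And>x. (v has_derivative D x) (at x)"
    and D: "\<And>i. continuous_on UNIV (\<lambda>x. D x (axis i 1))"
    and supp: "\<And>x. norm x > N \<Longrightarrow> v x = 0"
  shows "weighted_power_integral \<tau> (a * p * (d / (d - 1))) (p * (d / (d - 1))) v
    \<le> (p * (1 + \<bar>a\<bar>) * (\<integral>x. hyp_weight \<tau> x powr (a * p - 1) * norm (v x) powr (p - 1) *
          (norm (v x) + (\<Sum>i\<in>UNIV. hyp_weight \<tau> x * norm (D x (axis i 1)))) \<partial>lborel)) powr (d / (d - 1))"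
proof -
  define w where "w = (hyp_weight \<tau> :: real ^ 'd \<Rightarrow> real)"
  have w: "w x > 0" "norm x \<le> w x" for x
    using hyp_weight_pos[OF \<tau>] norm_le_hyp_weight by (auto simp: w_def)
  have vc: "continuous_on UNIV v"
    using v has_derivative_continuous continuous_at_imp_continuous_on by blast
  define f where "f x = w x powr (a * p) * norm (v x) powr p" for x
  define f' where "f' x h = w x powr (a * p) * (p * norm (v x) powr (p - 1) * (sgn (v x) \<bullet> D x h)) +
    (a * p * w x powr (a * p - 1) * ((x \<bullet> h) / w x)) * norm (v x) powr p" for x h
  define g where "g x = p * (1 + \<bar>a\<bar>) * (w x powr (a * p - 1) * norm (v x) powr (p - 1) *
          (norm (v x) + (\<Sum>i\<in>UNIV. w x * norm (D x (axis i 1)))))" for x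
  have "(\<integral>x. \<bar>f x\<bar> powr (real DIM(real ^ 'd) / (real DIM(real ^ 'd) - 1)) \<partial>lborel)
    \<le> (\<integral>x. g x \<partial>lborel) powr (real DIM(real ^ 'd) / (real DIM(real ^ 'd) - 1))"
  proof (rule Gagliardo_Nirenberg_Sobolev)
    show "DIM(real ^ 'd) \<ge> 2" using d by simp
    show "(f has_derivative f' x) (at x)" for x
      unfolding f_def f'_def w_def
      by (intro has_derivative_mult has_derivative_hyp_weight_powr \<tau>
          has_derivative_compose[OF v has_derivative_norm_powr[OF p]])
    show "continuous_on UNIV g"
      unfolding g_def w_def using \<tau> p by (intro continuous_intros vc D) auto
    show "f x = 0" "g x = 0" if "norm x > N" for x
      using supp[OF that] by (simp_all add: f_def g_def)
    show "\<bar>f' x b\<bar> \<le> g x" if "b \<in> Basis" for x b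
    proof -
      obtain i where i: "b = axis i 1"
        using \<open>b \<in> Basis\<close> by (auto simp: Basis_vec_def)
      define V where "V = w x powr (a * p - 1) * norm (v x) powr (p - 1)"
      have V: "V \<ge> 0" by (simp add: V_def)
      have e1: "w x powr (a * p) * norm (v x) powr (p - 1) = V * w x"
        using w(1)[of x] by (simp add: V_def powr_diff)
      have e2: "w x powr (a * p - 1) * norm (v x) powr p = V * norm (v x)"
        by (cases "v x = 0") (simp_all add: V_def powr_diff)
      have "f' x b = p * (V * w x) * (sgn (v x) \<bullet> D x b) + a * p * (V * norm (v x)) * ((x \<bullet> b) / w x)"
        unfolding f'_def e1[symmetric] e2[symmetric] by (simp add: mult_ac)
      also have "\<bar>\<dots>\<bar> \<le> p * (V * w x) * norm (D x b) + \<bar>a\<bar> * p * (V * norm (v x)) * 1"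
      proof -
        have "\<bar>sgn (v x) \<bullet> D x b\<bar> \<le> norm (sgn (v x)) * norm (D x b)"
          by (rule Cauchy_Schwarz_ineq2)
        also have "\<dots> \<le> 1 * norm (D x b)"
          by (intro mult_right_mono) (auto simp: norm_sgn)
        finally have "\<bar>p * (V * w x) * (sgn (v x) \<bullet> D x b)\<bar> \<le> p * (V * w x) * norm (D x b)"
          using p V w(1)[of x] by (simp add: abs_mult mult_left_mono)
        moreover have "\<bar>x \<bullet> b\<bar> \<le> w x"
          using Basis_le_norm[OF \<open>b \<in> Basis\<close>, of x] w(2)[of x] by linarith
        then have "\<bar>(x \<bullet> b) / w x\<bar> \<le> 1"
          using w(1)[of x] by simp
        then have "\<bar>a * p * (V * norm (v x)) * ((x \<bullet> b) / w x)\<bar> \<le> \<bar>a\<bar> * p * (V * norm (v x)) * 1"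
          using p V unfolding abs_mult by (intro mult_mono) (auto simp: abs_mult)
        ultimately show ?thesis by linarith
      qed
      also have "\<dots> = p * V * (w x * norm (D x b)) + p * \<bar>a\<bar> * V * norm (v x)"
        by (simp add: mult_ac)
      also have "\<dots> \<le> p * (1 + \<bar>a\<bar>) * (V * (norm (v x) + w x * norm (D x b)))"
        using p V w(1)[of x] by (simp add: algebra_simps)
      also have "\<dots> \<le> g x"
        unfolding g_def V_def[symmetric] i using p V w(1)[of x]
        by (intro mult_left_mono add_left_mono member_le_sum) (auto simp: less_imp_le)
      finally show ?thesis .
    qed
  qed
  moreover have "(\<integral>x. g x \<partial>lborel) = p * (1 + \<bar>a\<bar>) * (\<integral>x. w x powr (a * p - 1) * norm (v x) powr (p - 1) *
          (norm (v x) + (\<Sum>i\<in>UNIV. w x * norm (D x (axis i 1)))) \<partial>lborel)"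
    by (simp add: g_def)
  moreover have "\<bar>f x\<bar> powr (d / (d - 1)) =
      w x powr (a * p * (d / (d - 1))) * norm (v x) powr (p * (d / (d - 1)))" for x
    by (simp add: f_def powr_mult powr_powr abs_mult)
  ultimately show ?thesis
    by (simp add: weighted_power_integral_def d_def w_def)
qed

text \<open>
  The degenerate case \<open>q = r\<close> is included: then \<open>l = 1\<close>, and \<open>W powr 0\<close> on the right means that
  \<open>W = 0\<close> forces \<open>A = 0\<close>; this is so because \<open>S\<close>, and with it \<open>S powr 0\<close>, vanishes as soon as \<open>W\<close> does.
\<close>

lemma absorption:
  fixes A Q S W K m q r l :: real
  assumes nn: "0 \<le> A" "0 \<le> Q" "0 \<le> S" "0 \<le> W" "0 \<le> K" and "m > 0" "q \<le> r"
    and l_eq: "l = m / (r - q + m)"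
    and S: "S \<le> K * A * W powr m" and A: "A \<le> Q powr l * S powr (1 - l)"
  shows "A \<le> K powr ((r - q) / m) * Q * W powr (r - q)"
proof (cases "A = 0")
  case False
  then have "A > 0" using nn by simp
  have l: "0 < l" "l \<le> 1" and "1 - l = (r - q) / (r - q + m)"
    using \<open>m > 0\<close> \<open>q \<le> r\<close> by (auto simp: l_eq field_simps)
  then have l': "(1 - l) * (1 / l) = (r - q) / m"
    using \<open>m > 0\<close> \<open>q \<le> r\<close> by (simp add: l_eq)
  have "A \<le> Q powr l * (K * A * W powr m) powr (1 - l)"
    using A S l nn by (elim order_trans) (intro mult_left_mono powr_mono2, auto)
  also have "\<dots> = (Q powr l * K powr (1 - l) * W powr (m * (1 - l))) * A powr (1 - l)"
    using nn by (simp add: powr_mult powr_powr mult_ac)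
  finally have "A \<le> (Q powr l * K powr (1 - l) * W powr (m * (1 - l))) * A powr (1 - l)" .
  moreover have "A powr l * A powr (1 - l) = A"
    using \<open>A > 0\<close> by (simp flip: powr_add)
  ultimately have "A powr l * A powr (1 - l)
      \<le> (Q powr l * K powr (1 - l) * W powr (m * (1 - l))) * A powr (1 - l)"
    by linarith
  then have "A powr l \<le> Q powr l * K powr (1 - l) * W powr (m * (1 - l))"
    using \<open>A > 0\<close> by simp
  then have "(A powr l) powr (1 / l) \<le> (Q powr l * K powr (1 - l) * W powr (m * (1 - l))) powr (1 / l)"
    using l by (intro powr_mono2) auto
  also have "\<dots> = Q * K powr ((1 - l) * (1 / l)) * W powr (m * ((1 - l) * (1 / l)))"
    using l nn by (simp add: powr_mult powr_powr)
  finally show ?thesis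
    unfolding l' using l nn \<open>m > 0\<close> by (simp add: powr_powr mult_ac)
qed (use nn in simp)

lemma smooth_compact_supportE:
  fixes u :: "real \<times> (real ^ 'd) \<Rightarrow> 'b::real_normed_vector"
  assumes u: "smooth_compact_support \<tau> u" and "\<tau> > 0"
  defines "v \<equiv> u \<circ> hyp_param \<tau>"
  obtains N where "\<And>x. (v has_derivative frechet_derivative v (at x)) (at x)"
    "\<And>e. continuous_on UNIV (\<lambda>x. frechet_derivative v (at x) e)"
    "\<And>x. norm x > N \<Longrightarrow> v x = 0" "\<And>x e. norm x > N \<Longrightarrow> frechet_derivative v (at x) e = 0"
proof -
  have "k_times_cont_diff (Suc 0) v"
    using u by (simp add: smooth_compact_support_def smooth_fun_def v_def)
  then have D: "(v has_derivative frechet_derivative v (at x)) (at x)"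
    and c: "continuous_on UNIV (\<lambda>x. frechet_derivative v (at x) e)" for x e
    by (auto simp: frechet_derivative_works[symmetric])
  obtain K where K: "compact K" "K \<subseteq> hyperboloid \<tau>" "\<forall>p \<in> hyperboloid \<tau> - K. u p = 0"
    using u by (auto simp: smooth_compact_support_def)
  obtain N where N: "\<And>p. p \<in> K \<Longrightarrow> norm p \<le> N"
    using compact_imp_bounded[OF K(1)] by (auto simp: bounded_iff)
  have v0: "v x = 0" if "norm x > N" for x
  proof -
    have "norm x \<le> norm (hyp_param \<tau> x)"
      unfolding hyp_param_def by (rule norm_snd_le)
    then have "hyp_param \<tau> x \<notin> K" using N[of "hyp_param \<tau> x"] that by auto
    moreover have "hyp_param \<tau> x \<in> hyperboloid \<tau>"
      using \<open>\<tau> > 0\<close> by (simp add: hyperboloid_eq_range)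
    ultimately show ?thesis using K(3) by (simp add: v_def)
  qed
  have "frechet_derivative v (at x) e = 0" if "norm x > N" for x e
  proof -
    have "frechet_derivative v (at x) = frechet_derivative (\<lambda>_. 0) (at x)"
    proof (rule frechet_derivative_transform_within_open)
      show "v differentiable at x" using D by (auto simp: differentiable_def)
      show "open {x. norm x > N}" by (intro open_Collect_less continuous_intros)
    qed (use that v0 in auto)
    then show ?thesis by simp
  qed
  with D c v0 show ?thesis by (rule that)
qed

lemma L_norm_eq_weighted:
  assumes "\<tau> > 0"
  shows "L_norm \<tau> p e u = (\<tau> * weighted_power_integral \<tau> (e - 1) p (u \<circ> hyp_param \<tau>)) powr (1 / p)"
proof -
  have "hyp_weight \<tau> x powr e * norm (u (hyp_param \<tau> x)) powr p * (\<tau> / hyp_weight \<tau> x) =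
    \<tau> * (hyp_weight \<tau> x powr (e - 1) * norm ((u \<circ> hyp_param \<tau>) x) powr p)" for x
    using hyp_weight_pos[OF assms, of x] by (simp add: powr_diff)
  then show ?thesis
    unfolding L_norm_def weighted_power_integral_def by simp
qed

lemma W_norm_1:
  fixes u :: "real \<times> (real ^ 'd) \<Rightarrow> 'b::real_normed_vector"
  shows "W_norm \<tau> 1 p e u = L_norm \<tau> p e u + (\<Sum>i\<in>UNIV. L_norm \<tau> p e (boost \<tau> i u))"
proof -
  have "{is :: 'd list. length is = Suc 0} = (\<lambda>i. [i]) ` UNIV"
    by (auto simp: length_Suc_conv)
  then have "W_hom_norm \<tau> (Suc 0) p e u = (\<Sum>i\<in>UNIV. L_norm \<tau> p e (boost \<tau> i u))"
    by (simp add: W_hom_norm_def sum.reindex inj_on_def)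
  moreover have "W_hom_norm \<tau> 0 p e u = L_norm \<tau> p e u"
    by (simp add: W_hom_norm_def)
  ultimately show ?thesis
    by (simp add: W_norm_def)
qed

lemma boost_hyp_param:
  "boost \<tau> i u \<circ> hyp_param \<tau> =
    (\<lambda>x. hyp_weight \<tau> x *\<^sub>R frechet_derivative (u \<circ> hyp_param \<tau>) (at x) (axis i 1))"
  by (auto simp: boost_def hyp_param_def o_def)

section \<open>The interpolation inequality\<close>

theorem mainTheorem6:
  fixes d :: nat and one_star q r \<alpha> \<beta> \<theta> :: real
  assumes "CARD('d::finite) = d" and "d \<ge> 2"
    and "one_star = real d / (real d - 1)"
    and "1 \<le> q" and "q \<le> r"
    and "0 < \<theta>" and "\<theta> \<le> 1"
    and "1 / r = \<theta> / q + (1 - \<theta>) / (r + one_star)"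
  shows "\<exists>C::real. \<forall>\<tau>>0.
    \<forall>u :: real \<times> (real ^ 'd) \<Rightarrow> 'b::{real_normed_field, euclidean_space}.
      smooth_compact_support \<tau> u \<longrightarrow>
      (\<tau> powr (1 / real d)) powr ((r - q) / r)
          * L_norm \<tau> r (1 + \<theta> * \<beta> * r + \<alpha> * r) u
        \<le> C * L_norm \<tau> q (1 + \<beta> * q + \<alpha> * q) u powr (q / r)
            * W_norm \<tau> 1 (real d)
                ((1 - real d) * (1 + \<beta> * \<theta> * r) + \<alpha> * real d) u powr ((r - q) / r)"
proof -
  define m where "m = one_star"
  define t where "t = (real d - 1) / real d"
  define p where "p = 1 + r * t"
  define l where "l = \<theta> * r / q"
  define K where "K = p * (1 + \<bar>\<alpha>\<bar>)"
  \<comment> \<open>Powers of \<open>w\<close> in the integrals of \<open>|v|\<^sup>r\<close> and of \<open>|v|\<^sup>d\<close>, \<open>|w \<partial>\<^sub>i v|\<^sup>d\<close>: the weights of the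
    statement, less 1 for the density of the volume form.\<close>
  define e\<^sub>1 where "e\<^sub>1 = \<theta> * \<beta> * r + \<alpha> * r"
  define e\<^sub>2 where "e\<^sub>2 = \<alpha> * real d - real d - \<theta> * \<beta> * r * (real d - 1)"
  have rq: "r > 0" "q > 0" using assms by auto
  have d: "real d \<ge> 2" using assms by simp
  have t: "0 < t" "t < 1" "1 - t = 1 / real d" "t * m = 1"
    using d by (auto simp: t_def m_def assms(3) field_simps)
  have m: "m > 0" "m = real d / (real d - 1)" "real d \<noteq> 1"
    using d assms(3) by (auto simp: m_def)
  have p: "p > 1" "p * m = r + m" "p - 1 = r * t"
    using t rq by (auto simp: p_def algebra_simps)
  have K: "K \<ge> 0" using p by (simp add: K_def)
  have "1 = r * (1 / r)" using rq by simp
  also have "\<dots> = l + (1 - \<theta>) * r / (r + m)"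
    unfolding assms(8) by (simp add: l_def m_def algebra_simps add_divide_distrib)
  finally have l1: "1 = l + (1 - \<theta>) * r / (r + m)" .
  have ls: "(1 - l) * (r + m) = (1 - \<theta>) * r"
  proof -
    have "1 - l = (1 - \<theta>) * r / (r + m)" using l1 by linarith
    then show ?thesis using rq(1) m(1) by (simp only:) simp
  qed
  have lq: "l * q = \<theta> * r"
    using rq by (simp add: l_def)
  have "l * (r - q + m) = m"
    using ls lq by (simp add: algebra_simps)
  then have l: "l = m / (r - q + m)"
    using m(1) assms(5) by (simp add: nonzero_eq_divide_eq)
  then have l01: "0 \<le> l" "l \<le> 1"
    using m(1) assms(5) by simp_all
  have weights_Holder: "e\<^sub>1 * t + e\<^sub>2 * (1 - t) = \<alpha> * p - 1"
    unfolding t(3) using d by (simp add: e\<^sub>1_def e\<^sub>2_def p_def t_def field_simps)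
  have weights_interpolation: "(\<beta> * q + \<alpha> * q) * l + \<alpha> * (r + m) * (1 - l) = e\<^sub>1"
  proof -
    have "(\<beta> * q + \<alpha> * q) * l + \<alpha> * (r + m) * (1 - l) = (\<beta> + \<alpha>) * (l * q) + \<alpha> * ((1 - l) * (r + m))"
      by (simp add: algebra_simps)
    also have "\<dots> = e\<^sub>1"
      unfolding ls lq by (simp add: e\<^sub>1_def algebra_simps)
    finally show ?thesis .
  qed
  show ?thesis
  proof (intro exI allI impI)
    fix \<tau> :: real and u :: "real \<times> (real ^ 'd) \<Rightarrow> 'b"
    assume \<tau>: "\<tau> > 0" and u: "smooth_compact_support \<tau> u"
    define v where "v = u \<circ> hyp_param \<tau>"
    define D where "D x = frechet_derivative v (at x)" for x
    define h where "h i x = hyp_weight \<tau> x *\<^sub>R D x (axis i 1)" for i x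
    obtain N where v': "\<And>x. (v has_derivative D x) (at x)"
      and Dc: "\<And>e. continuous_on UNIV (\<lambda>x. D x e)"
      and v0: "\<And>x. norm x > N \<Longrightarrow> v x = 0" and D0: "\<And>x e. norm x > N \<Longrightarrow> D x e = 0"
      using smooth_compact_supportE[OF u \<tau>] unfolding v_def D_def by blast
    have vc: "continuous_on UNIV v"
      using v' has_derivative_continuous continuous_at_imp_continuous_on by blast
    have hc: "continuous_on UNIV (h i)" for i
      unfolding h_def by (intro continuous_intros Dc)
    have h0: "h i x = 0" if "norm x > N" for i x
      using D0[OF that] by (simp add: h_def)
    define A where "A = weighted_power_integral \<tau> e\<^sub>1 r v"
    define Q where "Q = weighted_power_integral \<tau> (\<beta> * q + \<alpha> * q) q v"
    define S where "S = weighted_power_integral \<tau> (\<alpha> * (r + m)) (r + m) v"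
    define W where "W = weighted_power_integral \<tau> e\<^sub>2 (real d) v powr (1 / real d)
      + (\<Sum>i\<in>UNIV. weighted_power_integral \<tau> e\<^sub>2 (real d) (h i) powr (1 / real d))"
    have nn: "0 \<le> A" "0 \<le> Q" "0 \<le> S" "0 \<le> W"
      by (auto simp: A_def Q_def S_def W_def weighted_power_integral_nonneg intro!: add_nonneg_nonneg sum_nonneg)
    \<comment> \<open>The gradient bound in the Sobolev step is \<open>K X\<close> times \<open>|v| + \<Sum>\<^sub>i |w \<partial>\<^sub>i v|\<close>. Splitting this sum
      before using the Hoelder inequality yields the sum of norms that defines the first-order norm.\<close>
    define X where "X x = hyp_weight \<tau> x powr (\<alpha> * p - 1) * norm (v x) powr (p - 1)" for x
    have X: "integrable lborel (\<lambda>x. X x * norm (k x))"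
        "(\<integral>x. X x * norm (k x) \<partial>lborel) \<le> A powr t * weighted_power_integral \<tau> e\<^sub>2 (real d) k powr (1 / real d)"
      if "continuous_on UNIV k" "\<And>x. norm x > N \<Longrightarrow> k x = 0" for k :: "real ^ 'd \<Rightarrow> 'b"
    proof -
      show "integrable lborel (\<lambda>x. X x * norm (k x))"
        by (rule integrable_continuous_compact_support[where N = N])
          (use that(2) p \<tau> in \<open>auto simp: X_def intro!: continuous_intros vc that(1)\<close>)
      have split: "hyp_weight \<tau> x powr (e\<^sub>1 * t + e\<^sub>2 * (1 - t)) *
          (norm (v x) powr (r * t) * norm (k x) powr (real d * (1 - t))) = X x * norm (k x)" for x
        unfolding weights_Holder using d by (simp add: X_def p(3) t(3) mult.assoc)
      have "(\<integral>x. X x * norm (k x) \<partial>lborel)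
          \<le> weighted_power_integral \<tau> e\<^sub>1 r v powr t * weighted_power_integral \<tau> e\<^sub>2 (real d) k powr (1 - t)"
        unfolding split[symmetric]
        by (rule weighted_power_integral_Holder[OF \<tau> rq(1) _ _ _ vc v0 that]) (use d t in auto)
      then show "(\<integral>x. X x * norm (k x) \<partial>lborel) \<le> A powr t * weighted_power_integral \<tau> e\<^sub>2 (real d) k powr (1 / real d)"
        by (simp add: A_def t(3))
    qed
    have "(\<integral>x. X x * (norm (v x) + (\<Sum>i\<in>UNIV. hyp_weight \<tau> x * norm (D x (axis i 1)))) \<partial>lborel)
      = (\<integral>x. X x * norm (v x) + (\<Sum>i\<in>UNIV. X x * norm (h i x)) \<partial>lborel)"
      by (simp add: h_def distrib_left sum_distrib_left abs_of_pos[OF hyp_weight_pos[OF \<tau>]])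
    also have "\<dots> = (\<integral>x. X x * norm (v x) \<partial>lborel) + (\<Sum>i\<in>UNIV. \<integral>x. X x * norm (h i x) \<partial>lborel)"
      using X(1)[OF vc v0] X(1)[OF hc h0]
      by (subst Bochner_Integration.integral_add) (auto simp: Bochner_Integration.integral_sum)
    also have "\<dots> \<le> A powr t * W"
      unfolding W_def distrib_left sum_distrib_left
      by (intro add_mono sum_mono X(2)) (use vc v0 hc h0 in auto)
    finally have gradient: "(\<integral>x. X x * (norm (v x) +
        (\<Sum>i\<in>UNIV. hyp_weight \<tau> x * norm (D x (axis i 1)))) \<partial>lborel) \<le> A powr t * W" .
    have "S \<le> (K * (\<integral>x. X x * (norm (v x) +
        (\<Sum>i\<in>UNIV. hyp_weight \<tau> x * norm (D x (axis i 1)))) \<partial>lborel)) powr m"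
      using weighted_Sobolev[OF \<tau> _ p(1) v' Dc v0, where a = \<alpha>] assms(1,2)
      by (simp add: S_def K_def X_def m(2)[symmetric] p(2) mult.assoc)
    also have "\<dots> \<le> (K * (A powr t * W)) powr m"
      using gradient K m(1)
      by (intro powr_mono2 mult_left_mono mult_nonneg_nonneg integral_nonneg_AE AE_I2 add_nonneg_nonneg
          sum_nonneg less_imp_le[OF hyp_weight_pos[OF \<tau>]])
        (auto simp: X_def)
    also have "\<dots> = K powr m * A * W powr m"
      using K nn t by (simp add: powr_mult powr_powr)
    finally have Sobolev: "S \<le> K powr m * A * W powr m" .
    have split: "hyp_weight \<tau> x powr ((\<beta> * q + \<alpha> * q) * l + \<alpha> * (r + m) * (1 - l)) *
        (norm (v x) powr (q * l) * norm (v x) powr ((r + m) * (1 - l)))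
      = hyp_weight \<tau> x powr e\<^sub>1 * norm (v x) powr r" for x
    proof -
      have "q * l + (r + m) * (1 - l) = r"
        using ls lq by (simp add: algebra_simps)
      then show ?thesis
        unfolding weights_interpolation by (simp flip: powr_add)
    qed
    have interpolation: "A \<le> Q powr l * S powr (1 - l)"
      unfolding A_def weighted_power_integral_def[of \<tau> e\<^sub>1 r v] split[symmetric] Q_def S_def
      by (rule weighted_power_integral_Holder[OF \<tau> rq(2) _ l01 vc v0 vc v0]) (use rq m(1) in auto)
    have main: "A \<le> (K powr m) powr ((r - q) / m) * Q * W powr (r - q)"
      by (rule absorption[OF nn _ m(1) assms(5) l Sobolev interpolation]) simp
    have L_r: "L_norm \<tau> r (1 + \<theta> * \<beta> * r + \<alpha> * r) u = (\<tau> * A) powr (1 / r)"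
      by (simp add: L_norm_eq_weighted[OF \<tau>] A_def e\<^sub>1_def v_def)
    have L_q: "L_norm \<tau> q (1 + \<beta> * q + \<alpha> * q) u = (\<tau> * Q) powr (1 / q)"
      by (simp add: L_norm_eq_weighted[OF \<tau>] Q_def v_def)
    have e2: "(1 - real d) * (1 + \<beta> * \<theta> * r) + \<alpha> * real d - 1 = e\<^sub>2"
      by (simp add: e\<^sub>2_def algebra_simps)
    have W: "W_norm \<tau> 1 (real d) ((1 - real d) * (1 + \<beta> * \<theta> * r) + \<alpha> * real d) u
        = \<tau> powr (1 / real d) * W"
    proof -
      have "boost \<tau> i u \<circ> hyp_param \<tau> = h i" for i
        by (simp add: boost_hyp_param h_def D_def v_def fun_eq_iff)
      then show ?thesis
        using \<tau> unfolding W_norm_1 L_norm_eq_weighted[OF \<tau>] e2 W_def v_def[symmetric]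
        by (simp add: powr_mult weighted_power_integral_nonneg distrib_left sum_distrib_left)
    qed
    \<comment> \<open>Both sides carry the factor \<open>\<tau>\<^bsup>1/r\<^esup> \<tau>\<^bsup>(r-q)/(rd)\<^esup>\<close>.\<close>
    have "(\<tau> powr (1 / real d)) powr ((r - q) / r) * (\<tau> * A) powr (1 / r)
      \<le> (\<tau> powr (1 / real d)) powr ((r - q) / r) *
        (\<tau> * ((K powr m) powr ((r - q) / m) * Q * W powr (r - q))) powr (1 / r)"
      using main \<tau> rq nn by (intro mult_left_mono powr_mono2) auto
    also have "\<dots> = ((K powr m) powr ((r - q) / m)) powr (1 / r) * ((\<tau> * Q) powr (1 / q)) powr (q / r) *
        (\<tau> powr (1 / real d) * W) powr ((r - q) / r)"
      using \<tau> rq nn by (simp add: powr_mult powr_powr mult_ac)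
    finally show "(\<tau> powr (1 / real d)) powr ((r - q) / r)
          * L_norm \<tau> r (1 + \<theta> * \<beta> * r + \<alpha> * r) u
        \<le> ((K powr m) powr ((r - q) / m)) powr (1 / r) * L_norm \<tau> q (1 + \<beta> * q + \<alpha> * q) u powr (q / r)
            * W_norm \<tau> 1 (real d)
                ((1 - real d) * (1 + \<beta> * \<theta> * r) + \<alpha> * real d) u powr ((r - q) / r)"
      unfolding L_r L_q W .
  qed
qed

end
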